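(* Let $S,n_h,M,d_h\ge 1$ be integers. For $1\le s\le S$, $1\le r\le n_h$ let $\mathbf Z_{s,r}\in\mathbb R^{M\times d_h}$, let $\mathbf A_{s,r}\in\mathbb R^{M\times M}$ be row-stochastic, let $\mathbf W_{v,r}\in\mathbb R^{d_h\times d_h}$, and set $\mathbf Z=(\mathbf Z_{s,r})$ and $\Delta\mathbf Z=(\mathbf A_{s,r}\mathbf Z_{s,r}\mathbf W_{v,r})$. With the norm $\|\cdot\|_{\mathcal D}$ and projection $\mathbf\Pi$ defined in the context, suppose that for some $q$ with $0\le q<1$, \[ s_Z:=\|\mathbf\Pi\mathbf Z\|_{\mathcal D}>0,\qquad \|\mathbf\Pi\Delta\mathbf Z\|_{\mathcal D}\le q\,s_Z . \] For each $s$ let $G_s$ be a fixed map from head tuples $(\mathbf X_{s,r})_{r=1}^{n_h}$ of $M\times d_h$ matrices to a space of real matrices of fixed size, let $G(\mathbf X)=(G_s((\mathbf X_{s,r})_{r}))_{s=1}^S$, and let $\mathbf Y=(\mathbf Y_s)_{s=1}^S$ be a target in the output space. Assume that for some $m>0$, \[ \|G(\Delta\mathbf Z)-G(\mathbf Z)\|_{\mathcal D}\ge m\|\mathbf\Pi(\Delta\mathbf Z-\mathbf Z)\|_{\mathcal D},\qquad 2\varepsilon_0<m(1-q)s_Z,\qquad \varepsilon_0:=\|G(\mathbf Z)-\mathbf Y\|_{\mathcal D}. \] Define $\phi(\gamma)=\|G(\mathbf Z+\gamma\Delta\mathbf Z)-\mathbf Y\|_{\mathcal D}^2$ for real $\gamma$.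 Suppose that, for some $r_0,\beta>0$, $\phi$ is differentiable on $[-r_0,r_0]$ with $\beta$-Lipschitz derivative there, and that $g:=\phi'(0)\neq0$. Then $d:=\|\Delta\mathbf Z\|_{\mathcal D}>0$, and for any $\xi$ with $0<\xi<1$ and any $t$ satisfying \[ 0<t<\min\{r_0,\;2|g|/\beta,\;\xi s_Z/d\},\qquad tq<1-q, \] the scalar $\gamma=-t\,\operatorname{sign}(g)$ satisfies \[ \phi(\gamma)<\phi(0)<\|G(\Delta\mathbf Z)-\mathbf Y\|_{\mathcal D}^2, \] \[ \|\gamma\mathbf\Pi\Delta\mathbf Z\|_{\mathcal D}\le\|\gamma\Delta\mathbf Z\|_{\mathcal D}<\xi s_Z, \] \[ \|\mathbf\Pi(\mathbf Z+\gamma\Delta\mathbf Z)\|_{\mathcal D}>q s_Z\ge\|\mathbf\Pi\Delta\mathbf Z\|_{\mathcal D}. \]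
   Context: For tuples $\mathbf X=(\mathbf X_{s,r})$ of real $M\times d_h$ matrices ($1\le s\le S$, $1\le r\le n_h$), the cohort norm is $\|\mathbf X\|_{\mathcal D}=\big(S^{-1}\sum_{s=1}^S\sum_{r=1}^{n_h}\|\mathbf X_{s,r}\|_F^2\big)^{1/2}$ (induced by $\langle\mathbf X,\mathbf Y\rangle_{\mathcal D}=S^{-1}\sum_{s,r}\langle\mathbf X_{s,r},\mathbf Y_{s,r}\rangle_F$). The centering projection $\mathbf\Pi=\mathbf I_M-M^{-1}\mathbf 1_M\mathbf 1_M^\top$ acts on each component by left multiplication. On output tuples $\mathbf V=(\mathbf V_s)_{s=1}^S$ of real matrices, the cohort norm is $\|\mathbf V\|_{\mathcal D}=\big(S^{-1}\sum_{s=1}^S\|\mathbf V_s\|_F^2\big)^{1/2}$. The matrices $\mathbf A_{s,r}$ are fixed given matrices (attention matrices evaluated at the given inputs); row-stochastic means nonnegative entries with each row summing to one. $G_s$ models the fixed network downstream of the slice update for input $s$, with all its other inputs held fixed. *)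

theory Defs
  imports "HOL-Analysis.Analysis"
begin

text \<open>
  The integers \<open>S, n_h, M, d_h \<ge> 1\<close> are the cardinalities of the finite index types
  \<open>'s, 'h, 'm, 'd\<close>. Tuples of matrices are nested vectors, so that
  addition, subtraction and scalar multiplication act componentwise;
  \<open>X $ s $ r\<close> is the \<open>M \<times> d_h\<close> matrix for input \<open>s\<close> and head \<open>r\<close>.
\<close>

type_synonym ('d, 'm, 'h) head_tuple = "((real ^ 'd) ^ 'm) ^ 'h"
type_synonym ('d, 'm, 'h, 's) cohort = "('d, 'm, 'h) head_tuple ^ 's"

text \<open>The library norm on matrices is the Frobenius norm.\<close>

lemma norm_matrix_eq_Frobenius:
  fixes A :: "real ^ 'n ^ 'k"
  shows "norm A = sqrt (\<Sum>i\<in>UNIV. \<Sum>j\<in>UNIV. (A $ i $ j)\<^sup>2)"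
  by (simp add: norm_vec_def L2_set_def sum_nonneg)

definition cohort_norm :: "('d::finite, 'm::finite, 'h::finite, 's::finite) cohort \<Rightarrow> real" where
  "cohort_norm X = sqrt ((\<Sum>s\<in>UNIV. \<Sum>r\<in>UNIV. (norm (X $ s $ r))\<^sup>2) / real CARD('s))"

definition output_norm :: "real ^ 'c::finite ^ 'l::finite ^ 's::finite \<Rightarrow> real" where
  "output_norm V = sqrt ((\<Sum>s\<in>UNIV. (norm (V $ s))\<^sup>2) / real CARD('s))"

definition centering_matrix :: "real ^ 'm::finite ^ 'm" where
  "centering_matrix = mat 1 - (1 / real CARD('m)) *\<^sub>R (\<chi> i j. 1)"

definition center ::
    "('d::finite, 'm::finite, 'h::finite, 's::finite) cohort \<Rightarrow> ('d, 'm, 'h, 's) cohort" where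
  "center X = (\<chi> s r. centering_matrix ** X $ s $ r)"

definition row_stochastic :: "real ^ 'm::finite ^ 'm \<Rightarrow> bool" where
  "row_stochastic A \<longleftrightarrow> (\<forall>i j. 0 \<le> A $ i $ j) \<and> (\<forall>i. (\<Sum>j\<in>UNIV. A $ i $ j) = 1)"

definition attention_update ::
    "('s \<Rightarrow> 'h \<Rightarrow> real ^ 'm ^ 'm) \<Rightarrow> ('h \<Rightarrow> real ^ 'd ^ 'd) \<Rightarrow>
     ('d::finite, 'm::finite, 'h::finite, 's::finite) cohort \<Rightarrow> ('d, 'm, 'h, 's) cohort" where
  "attention_update A W Z = (\<chi> s r. A s r ** Z $ s $ r ** W r)"

definition cohort_map ::
    "('s \<Rightarrow> ('d, 'm, 'h) head_tuple \<Rightarrow> real ^ 'c ^ 'l) \<Rightarrow>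
     ('d::finite, 'm::finite, 'h::finite, 's::finite) cohort \<Rightarrow> real ^ 'c::finite ^ 'l::finite ^ 's" where
  "cohort_map G X = (\<chi> s. G s (X $ s))"

end

theory Submission
  imports Defs
begin

text \<open>
  The cohort norms are Euclidean norms scaled by \<open>1 / sqrt S\<close>, and centering is linear and
  nonexpansive, since subtracting the mean of a column does not increase its sum of squares.
  The Lipschitz derivative gives the quadratic upper bound
  \<open>\<phi> \<gamma> \<le> \<phi> 0 - t \<bar>g\<bar> + \<beta> t\<^sup>2 / 2\<close>, which is below \<open>\<phi> 0\<close> for \<open>0 < t < 2 \<bar>g\<bar> / \<beta>\<close>.
  The remaining inequalities are triangle inequalities; \<open>d > 0\<close> because \<open>\<Delta>Z = 0\<close> would make \<open>\<phi>\<close> constant.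
\<close>

text \<open>The entry type is left general, so each use collapses one level of a nested vector: one
  for \<open>output_norm\<close>, two for \<open>cohort_norm\<close>.\<close>

lemma norm_vec_squared: "(norm X)\<^sup>2 = (\<Sum>i\<in>UNIV. (norm (X $ i))\<^sup>2)"
  by (simp add: norm_vec_def L2_set_def sum_nonneg)

lemma output_norm_eq_norm: "output_norm (V :: real ^ 'c::finite ^ 'l::finite ^ 's::finite)
    = norm V / sqrt (real CARD('s))"
  by (simp add: output_norm_def real_sqrt_divide flip: norm_vec_squared)

lemma cohort_norm_eq_norm: "cohort_norm (X :: ('d::finite, 'm::finite, 'h::finite, 's::finite) cohort)
    = norm X / sqrt (real CARD('s))"
  by (simp add: cohort_norm_def real_sqrt_divide flip: norm_vec_squared)

lemma output_norm_triangle: "output_norm (U + V) \<le> output_norm U + output_norm V"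
  unfolding output_norm_eq_norm
  by (simp add: norm_triangle_ineq divide_right_mono flip: add_divide_distrib)

lemma output_norm_uminus: "output_norm (- V) = output_norm V"
  by (simp add: output_norm_eq_norm)

lemma cohort_norm_triangle: "cohort_norm (U + V) \<le> cohort_norm U + cohort_norm V"
  unfolding cohort_norm_eq_norm
  by (simp add: norm_triangle_ineq divide_right_mono flip: add_divide_distrib)

lemma cohort_norm_scaleR: "cohort_norm (c *\<^sub>R X) = \<bar>c\<bar> * cohort_norm X"
  by (simp add: cohort_norm_eq_norm)

lemma cohort_norm_nonneg: "0 \<le> cohort_norm X"
  by (simp add: cohort_norm_eq_norm)

lemma cohort_norm_eq_0_iff: "cohort_norm X = 0 \<longleftrightarrow> X = 0"
  by (simp add: cohort_norm_eq_norm)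

lemma cohort_norm_reverse_triangle: "cohort_norm U - cohort_norm V \<le> cohort_norm (U + V)"
  using cohort_norm_triangle[of "U + V" "- V"] cohort_norm_scaleR[of "-1" V] by simp

lemma centering_matrix_mult_nth:
  "(centering_matrix ** B) $ i $ j = B $ i $ j - (\<Sum>k\<in>UNIV. B $ k $ j) / real CARD('m)"
  for B :: "real ^ 'd ^ 'm::finite"
proof -
  have "(centering_matrix ** B) $ i $ j
      = (\<Sum>k\<in>UNIV. (if i = k then B $ k $ j else 0) - B $ k $ j / real CARD('m))"
    unfolding centering_matrix_def matrix_matrix_mult_def mat_def
    by (auto intro!: sum.cong simp: algebra_simps)
  then show ?thesis
    by (simp add: sum_subtractf sum_divide_distrib)
qed

lemma center_add: "center (X + Y) = center X + center Y"
  by (simp add: center_def vec_eq_iff matrix_add_ldistrib)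

lemma center_scaleR: "center (c *\<^sub>R X) = c *\<^sub>R center X"
  by (simp add: center_def vec_eq_iff matrix_matrix_mult_def sum_distrib_left mult_ac)

lemma center_diff: "center (X - Y) = center X - center Y"
  using center_add[of "X - Y" Y] by simp

text \<open>This is the variance identity: with mean \<open>a\<close>, the cross term contributes
  \<open>- 2 * M * a\<^sup>2\<close> and the constant term \<open>M * a\<^sup>2\<close>, so
  centering removes exactly \<open>M * a\<^sup>2\<close>, where M is the number of indices.\<close>

lemma sum_squares_sub_mean_le:
  fixes f :: "'m::finite \<Rightarrow> real"
  shows "(\<Sum>i\<in>UNIV. (f i - sum f UNIV / real CARD('m))\<^sup>2) \<le> (\<Sum>i\<in>UNIV. (f i)\<^sup>2)"
proof -
  define a where "a = sum f UNIV / real CARD('m)"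
  have a: "sum f UNIV = a * real CARD('m)"
    by (simp add: a_def)
  have "(\<Sum>i\<in>UNIV. (f i - a)\<^sup>2) = (\<Sum>i\<in>UNIV. (f i)\<^sup>2) - 2 * a * sum f UNIV + real CARD('m) * a\<^sup>2"
    by (simp add: power2_diff sum.distrib sum_subtractf mult_ac flip: sum_distrib_left sum_distrib_right)
  also have "\<dots> = (\<Sum>i\<in>UNIV. (f i)\<^sup>2) - real CARD('m) * a\<^sup>2"
    unfolding a by (simp add: power2_eq_square)
  finally show ?thesis
    by (simp add: a_def)
qed

text \<open>Centering acts on each column separately, so the squared Frobenius norm is summed column
  by column and the scalar inequality applies to every column.\<close>

lemma norm_centering_matrix_mult_le: "norm (centering_matrix ** B) \<le> norm B"
  for B :: "real ^ 'd::finite ^ 'm::finite"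
proof -
  have sq: "(norm C)\<^sup>2 = (\<Sum>j\<in>UNIV. \<Sum>i\<in>UNIV. (C $ i $ j)\<^sup>2)" for C :: "real ^ 'd ^ 'm"
    by (subst sum.swap) (simp add: norm_vec_squared)
  have "(norm (centering_matrix ** B))\<^sup>2 \<le> (norm B)\<^sup>2"
    unfolding sq centering_matrix_mult_nth by (intro sum_mono sum_squares_sub_mean_le)
  then show ?thesis
    by (rule power2_le_imp_le) simp
qed

lemma cohort_norm_center_le: "cohort_norm (center X) \<le> cohort_norm X"
  unfolding cohort_norm_def center_def
  by (auto intro!: divide_right_mono sum_mono power_mono norm_centering_matrix_mult_le)

text \<open>The difference between f and the quadratic bound is nonincreasing along the segment from
  0 to x, because its derivative is the variation of f' minus the Lipschitz bound for it.\<close>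

lemma lipschitz_derivative_descent:
  fixes f f' :: "real \<Rightarrow> real"
  assumes deriv: "\<And>x. x \<in> {-r..r} \<Longrightarrow> (f has_real_derivative f' x) (at x within {-r..r})"
    and lip: "\<beta>-lipschitz_on {-r..r} f'"
    and x: "\<bar>x\<bar> < r"
  shows "f x \<le> f 0 + f' 0 * x + \<beta> / 2 * x\<^sup>2"
proof -
  \<comment> \<open>The direction of x: substituting \<open>\<sigma> * u\<close> treats both signs
    of x by one monotonicity argument on \<open>[0, \<bar>x\<bar>]\<close>. The value at x = 0 only
    has to have modulus 1.\<close>
  define \<sigma> where "\<sigma> = (if x < 0 then - 1 else 1 :: real)"
  have \<sigma>: "\<sigma> * \<bar>x\<bar> = x" "\<bar>\<sigma>\<bar> = 1" "\<sigma> * \<sigma> = 1"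
    by (auto simp: \<sigma>_def)
  define k where "k u = f (\<sigma> * u) - \<sigma> * f' 0 * u - \<beta> / 2 * u\<^sup>2" for u
  have "k \<bar>x\<bar> \<le> k 0"
  proof (rule DERIV_nonpos_imp_nonincreasing[of 0 "\<bar>x\<bar>" k])
    fix u assume u: "0 \<le> u" "u \<le> \<bar>x\<bar>"
    \<comment> \<open>The strict bound on x keeps the segment in the open interval, where the
      derivative within the closed interval is an ordinary one.\<close>
    have mem: "\<sigma> * u \<in> {-r<..<r}"
      using u x by (auto simp: \<sigma>_def)
    have "(f has_real_derivative f' (\<sigma> * u)) (at (\<sigma> * u))"
      using deriv[of "\<sigma> * u"] mem by (simp add: at_within_Icc_at)
    then have "(k has_real_derivative f' (\<sigma> * u) * \<sigma> - \<sigma> * f' 0 - \<beta> * u) (at u)"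
      unfolding k_def by (auto intro!: derivative_eq_intros DERIV_chain2[where f = f])
    moreover have "f' (\<sigma> * u) * \<sigma> - \<sigma> * f' 0 - \<beta> * u \<le> 0"
    proof -
      have "\<bar>f' (\<sigma> * u) - f' 0\<bar> \<le> \<beta> * \<bar>\<sigma> * u - 0\<bar>"
        using lipschitz_onD[OF lip, of "\<sigma> * u" 0] mem x by (simp add: dist_real_def)
      then have "\<bar>f' (\<sigma> * u) - f' 0\<bar> \<le> \<beta> * u"
        using u \<sigma> by (simp add: abs_mult)
      then show ?thesis
        by (auto simp: \<sigma>_def abs_le_iff)
    qed
    ultimately show "\<exists>y. (k has_real_derivative y) (at u) \<and> y \<le> 0"
      by blast
  qed simp
  moreover have "\<sigma> * f' 0 * \<bar>x\<bar> = f' 0 * x"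
    using \<sigma>(1) by (metis mult.assoc mult.commute)
  ultimately show ?thesis
    by (simp add: k_def \<sigma>)
qed

theorem proposition4:
  fixes Z \<Delta>Z :: "('d::finite, 'm::finite, 'h::finite, 's::finite) cohort"
    and A :: "'s \<Rightarrow> 'h \<Rightarrow> real ^ 'm ^ 'm"
    and W\<^sub>v :: "'h \<Rightarrow> real ^ 'd ^ 'd"
    and G :: "'s \<Rightarrow> ('d, 'm, 'h) head_tuple \<Rightarrow> real ^ 'c::finite ^ 'l::finite"
    and Y :: "real ^ 'c ^ 'l ^ 's"
    and \<phi> \<phi>' :: "real \<Rightarrow> real"
    and q s\<^sub>Z m \<epsilon>\<^sub>0 r\<^sub>0 \<beta> g d :: real
  assumes "\<And>s r. row_stochastic (A s r)"
    and "\<Delta>Z = attention_update A W\<^sub>v Z"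
    and "0 \<le> q" and "q < 1"
    and "s\<^sub>Z = cohort_norm (center Z)" and "s\<^sub>Z > 0"
    and "cohort_norm (center \<Delta>Z) \<le> q * s\<^sub>Z"
    and "m > 0"
    and "output_norm (cohort_map G \<Delta>Z - cohort_map G Z) \<ge> m * cohort_norm (center (\<Delta>Z - Z))"
    and "\<epsilon>\<^sub>0 = output_norm (cohort_map G Z - Y)"
    and "2 * \<epsilon>\<^sub>0 < m * (1 - q) * s\<^sub>Z"
    and "\<phi> = (\<lambda>\<gamma>. (output_norm (cohort_map G (Z + \<gamma> *\<^sub>R \<Delta>Z) - Y))\<^sup>2)"
    and "r\<^sub>0 > 0" and "\<beta> > 0"
    and "\<And>\<gamma>. \<gamma> \<in> {-r\<^sub>0..r\<^sub>0} \<Longrightarrow> (\<phi> has_real_derivative \<phi>' \<gamma>) (at \<gamma> within {-r\<^sub>0..r\<^sub>0})"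
    and "\<beta>-lipschitz_on {-r\<^sub>0..r\<^sub>0} \<phi>'"
    and "g = \<phi>' 0" and "g \<noteq> 0"
    and "d = cohort_norm \<Delta>Z"
  shows "d > 0 \<and>
    (\<forall>\<xi> t \<gamma>. 0 < \<xi> \<longrightarrow> \<xi> < 1 \<longrightarrow>
       0 < t \<longrightarrow> t < Min {r\<^sub>0, 2 * \<bar>g\<bar> / \<beta>, \<xi> * s\<^sub>Z / d} \<longrightarrow> t * q < 1 - q \<longrightarrow>
       \<gamma> = - t * sgn g \<longrightarrow>
         (\<phi> \<gamma> < \<phi> 0 \<and> \<phi> 0 < (output_norm (cohort_map G \<Delta>Z - Y))\<^sup>2) \<and>
         (cohort_norm (\<gamma> *\<^sub>R center \<Delta>Z) \<le> cohort_norm (\<gamma> *\<^sub>R \<Delta>Z) \<and>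
          cohort_norm (\<gamma> *\<^sub>R \<Delta>Z) < \<xi> * s\<^sub>Z) \<and>
         (cohort_norm (center (Z + \<gamma> *\<^sub>R \<Delta>Z)) > q * s\<^sub>Z \<and>
          q * s\<^sub>Z \<ge> cohort_norm (center \<Delta>Z)))"
proof -
  have qle: "cohort_norm (center \<Delta>Z) \<le> q * s\<^sub>Z"
    using assms(7) .
  have "\<Delta>Z \<noteq> 0"
  proof
    assume "\<Delta>Z = 0"
    then have "\<phi> = (\<lambda>_. \<phi> 0)"
      using assms(12) by auto
    \<comment> \<open>Since 0 is interior to the interval, this is a two-sided derivative, and
      uniqueness of derivatives applies.\<close>
    moreover have "(\<phi> has_real_derivative \<phi>' 0) (at 0)"
      using assms(15)[of 0] assms(13) by (simp add: at_within_Icc_at)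
    ultimately have "\<phi>' 0 = 0"
      by (metis DERIV_const DERIV_unique)
    with assms(17,18) show False by simp
  qed
  then have d: "d > 0"
    using cohort_norm_nonneg[of \<Delta>Z] cohort_norm_eq_0_iff[of \<Delta>Z] assms(19) by linarith
  have base: "\<phi> 0 < (output_norm (cohort_map G \<Delta>Z - Y))\<^sup>2"
  proof -
    \<comment> \<open>The centered update has norm at most \<open>q * s\<^sub>Z\<close>, so it stays
      at least \<open>(1 - q) * s\<^sub>Z\<close> away from the centered \<open>Z\<close>, which has
      norm \<open>s\<^sub>Z\<close>.\<close>
    have "(1 - q) * s\<^sub>Z \<le> cohort_norm (center (\<Delta>Z - Z))"
      using cohort_norm_reverse_triangle[of "- center Z" "center \<Delta>Z"]
        cohort_norm_scaleR[of "-1" "center Z"] qle assms(5)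
      by (simp add: center_diff algebra_simps)
    then have "m * ((1 - q) * s\<^sub>Z) \<le> output_norm (cohort_map G \<Delta>Z - cohort_map G Z)"
      using assms(8,9) by (meson mult_left_mono less_imp_le order_trans)
    \<comment> \<open>Passing through the target \<open>Y\<close> costs one
      \<open>\<epsilon>\<^sub>0\<close>; the factor 2 in the hypothesis leaves an output error above
      another \<open>\<epsilon>\<^sub>0\<close>.\<close>
    also have "\<dots> \<le> output_norm (cohort_map G \<Delta>Z - Y) + \<epsilon>\<^sub>0"
      using output_norm_triangle[of "cohort_map G \<Delta>Z - Y" "- (cohort_map G Z - Y)"]
      unfolding output_norm_uminus assms(10) by simp
    finally have "\<epsilon>\<^sub>0 < output_norm (cohort_map G \<Delta>Z - Y)"
      using assms(11) by (simp add: mult.assoc)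
    moreover have "0 \<le> \<epsilon>\<^sub>0"
      unfolding assms(10) output_norm_eq_norm by simp
    ultimately have "\<epsilon>\<^sub>0\<^sup>2 < (output_norm (cohort_map G \<Delta>Z - Y))\<^sup>2"
      by (simp add: power_strict_mono)
    then show ?thesis
      by (simp add: assms(10,12))
  qed
  have step: "\<phi> \<gamma> < \<phi> 0" "cohort_norm (\<gamma> *\<^sub>R \<Delta>Z) < \<xi> * s\<^sub>Z"
    "cohort_norm (center (Z + \<gamma> *\<^sub>R \<Delta>Z)) > q * s\<^sub>Z"
    if t: "0 < t" "t < Min {r\<^sub>0, 2 * \<bar>g\<bar> / \<beta>, \<xi> * s\<^sub>Z / d}" "t * q < 1 - q"
      and \<gamma>: "\<gamma> = - t * sgn g" for \<xi> t \<gamma>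
  proof -
    have lt: "t < r\<^sub>0" "t < 2 * \<bar>g\<bar> / \<beta>" "t < \<xi> * s\<^sub>Z / d"
      using t(2) by auto
    have abs\<gamma>: "\<bar>\<gamma>\<bar> = t"
      using \<gamma> t(1) assms(18) by (simp add: abs_mult abs_sgn_eq)
    have "\<phi> \<gamma> \<le> \<phi> 0 + g * \<gamma> + \<beta> / 2 * \<gamma>\<^sup>2"
      unfolding assms(17) by (rule lipschitz_derivative_descent[OF assms(15,16)]) (use abs\<gamma> lt in auto)
    also have "g * \<gamma> = - t * \<bar>g\<bar>"
      unfolding \<gamma> by (simp add: abs_sgn[of g] mult_ac)
    also have "\<gamma>\<^sup>2 = t\<^sup>2"
      using abs\<gamma> by (metis power2_abs)
    also have "\<phi> 0 + - t * \<bar>g\<bar> + \<beta> / 2 * t\<^sup>2 = \<phi> 0 + t * (\<beta> * t / 2 - \<bar>g\<bar>)"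
      by (simp add: algebra_simps power2_eq_square)
    \<comment> \<open>The second factor is negative precisely because
      \<open>t < 2 * \<bar>g\<bar> / \<beta>\<close>.\<close>
    also have "\<dots> < \<phi> 0"
      using lt(2) assms(14) t(1) by (simp add: mult_pos_neg field_simps)
    finally show "\<phi> \<gamma> < \<phi> 0" .
    show "cohort_norm (\<gamma> *\<^sub>R \<Delta>Z) < \<xi> * s\<^sub>Z"
      using lt(3) d assms(19) by (simp add: cohort_norm_scaleR abs\<gamma> field_simps)
    \<comment> \<open>The condition \<open>t * q < 1 - q\<close> says \<open>q < 1 - t * q\<close>,
      and a step of size t lowers the centered norm by at most
      \<open>t * q * s\<^sub>Z\<close>.\<close>
    have "q * s\<^sub>Z < (1 - t * q) * s\<^sub>Z"
      using t(3) assms(6) by simp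
    also have "\<dots> \<le> s\<^sub>Z - t * cohort_norm (center \<Delta>Z)"
      using mult_left_mono[OF qle, of t] t(1) by (simp add: algebra_simps)
    also have "\<dots> \<le> cohort_norm (center (Z + \<gamma> *\<^sub>R \<Delta>Z))"
      using cohort_norm_reverse_triangle[of "center Z" "\<gamma> *\<^sub>R center \<Delta>Z"] assms(5)
      by (simp add: center_add center_scaleR cohort_norm_scaleR abs\<gamma>)
    finally show "cohort_norm (center (Z + \<gamma> *\<^sub>R \<Delta>Z)) > q * s\<^sub>Z" .
  qed
  have "cohort_norm (\<gamma> *\<^sub>R center \<Delta>Z) \<le> cohort_norm (\<gamma> *\<^sub>R \<Delta>Z)" for \<gamma>
    using cohort_norm_center_le[of "\<gamma> *\<^sub>R \<Delta>Z"] by (simp add: center_scaleR)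
  with d base step qle show ?thesis
    by blast
qed

end
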